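(* Let $N\ge2$ and let $\mathbf\Phi^N=(\phi_1,\dots,\phi_{N-1})$, together with $\mu_{\phi_1},\dots,\mu_{\phi_{N-1}}$, be a sufficiently smooth solution on $\Omega$ of the $N$-phase Cahn–Hilliard system: for $i=1,\dots,N-1$, $$\frac{\partial\phi_i}{\partial t}=\nabla\cdot\big(M_i\nabla\mu_{\phi_i}\big),$$ $$\mu_{\phi_i}=-\varepsilon_i\nabla\cdot\big(\gamma_i^N\nabla\phi_i\big)+\frac1{\varepsilon_i}\gamma_i^Nf(\phi_i)+\sum_{j=1}^{N-1}\frac{\partial\gamma_j^N}{\partial\phi_i}\Big(\frac{\varepsilon_j}{2}|\nabla\phi_j|^2+\frac1{\varepsilon_j}F(\phi_j)\Big),$$ with boundary conditions $\partial_n\phi_i=0$ and $\partial_n\mu_{\phi_i}=0$ on $\partial\Omega$. Then $$\frac{d}{dt}W^N(\mathbf\Phi^N)=-\int_\Omega\sum_{i=1}^{N-1}M_i|\nabla\mu_{\phi_i}|^2\,d\mathbf x\le0.$$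
   Context: $\Omega\subset\mathbb R^d$ ($d=2,3$) is a bounded domain regular enough for the divergence theorem, with outward normal derivative $\partial_n$ on $\partial\Omega$. The phase-field variables $\phi_i=\phi_i(\mathbf x,t)$ are real-valued; $\varepsilon_i>0$ are constants; $F(\phi)=\frac14(\phi^2-1)^2$ and $f=F'$. The surface tension functions $\gamma_i^N=\gamma_i^N(\mathbf\Phi^N):\mathbb R^{N-1}\to\mathbb R$ are smooth and assumed independent of their $i$-th argument $\phi_i$. The mobilities $M_i=M_i(\mathbf\Phi^N)\ge0$ are smooth functions of $\mathbf\Phi^N$. The mixing energy is $$W^N(\mathbf\Phi^N)=\int_\Omega\sum_{i=1}^{N-1}\gamma_i^N(\mathbf\Phi^N)\Big(\frac{\varepsilon_i}{2}|\nabla\phi_i|^2+\frac1{\varepsilon_i}F(\phi_i)\Big)\,d\mathbf x.$$ *)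

theory Defs
  imports "HOL-Analysis.Analysis"
begin

(* All partial derivatives of g of order at most k exist on the open set S, are continuous
   there, and extend continuously to T (where S is contained in T and T in closure S).
   C_upto k S S is the usual class C^k(S), and C_upto k S (closure S) is C^k up to the
   boundary. Values of g outside S play no role. *)
primrec C_upto ::
    "nat \<Rightarrow> 'a::euclidean_space set \<Rightarrow> 'a set \<Rightarrow> ('a \<Rightarrow> real) \<Rightarrow> bool" where
  "C_upto 0 S T g \<longleftrightarrow> (\<exists>h. continuous_on T h \<and> (\<forall>x\<in>S. h x = g x))"
| "C_upto (Suc k) S T g \<longleftrightarrow>
     (\<exists>h. continuous_on T h \<and> (\<forall>x\<in>S. h x = g x)) \<and>
     (\<forall>x\<in>S. g differentiable (at x)) \<and>
     (\<forall>b\<in>Basis. C_upto k S T (\<lambda>x. frechet_derivative g (at x) b))"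

definition smooth :: "('a::euclidean_space \<Rightarrow> real) \<Rightarrow> bool" where
  "smooth g \<longleftrightarrow> (\<forall>k. C_upto k UNIV UNIV g)"

definition grad :: "('a::euclidean_space \<Rightarrow> real) \<Rightarrow> 'a \<Rightarrow> 'a" where
  "grad g x = (\<Sum>b\<in>Basis. frechet_derivative g (at x) b *\<^sub>R b)"

definition divergence :: "('a::euclidean_space \<Rightarrow> 'a) \<Rightarrow> 'a \<Rightarrow> real" where
  "divergence v x = (\<Sum>b\<in>Basis. frechet_derivative v (at x) b \<bullet> b)"

definition partial_deriv :: "'n::finite \<Rightarrow> (real ^ 'n \<Rightarrow> real) \<Rightarrow> real ^ 'n \<Rightarrow> real" where
  "partial_deriv i g u = frechet_derivative g (at u) (axis i 1)"

(* Hausdorff measure, normalised so that for integer s it is the s-dimensional surface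
   measure. The covering sets must be required to be bounded because diameter is
   meaningless on unbounded sets. *)
definition hausdorff_premeasure :: "real \<Rightarrow> real \<Rightarrow> 'a::metric_space set \<Rightarrow> ennreal" where
  "hausdorff_premeasure s \<delta> A =
     (INF U \<in> {U :: nat \<Rightarrow> 'a set. A \<subseteq> (\<Union>n. U n) \<and> (\<forall>n. bounded (U n) \<and> diameter (U n) \<le> \<delta>)}.
        (\<Sum>n. ennreal (unit_ball_vol s * (diameter (U n) / 2) powr s)))"

definition hausdorff_measure :: "real \<Rightarrow> 'a::metric_space measure" where
  "hausdorff_measure s =
     measure_of UNIV (sets borel) (\<lambda>A. SUP \<delta>\<in>{0<..}. hausdorff_premeasure s \<delta> A)"

definition surface_measure :: "'a::euclidean_space measure" where
  "surface_measure = hausdorff_measure (real DIM('a) - 1)"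

(* Near x the boundary is tangent to the hyperplane orthogonal to \<nu>, and S lies on the
   side opposite to \<nu>. On a C^1 domain this holds at every boundary point, on a Lipschitz
   domain at almost every one. *)
definition is_outward_unit_normal :: "'a::euclidean_space set \<Rightarrow> 'a \<Rightarrow> 'a \<Rightarrow> bool" where
  "is_outward_unit_normal S x \<nu> \<longleftrightarrow>
     x \<in> frontier S \<and> norm \<nu> = 1 \<and>
     (\<forall>e>0. \<exists>r>0. \<forall>y\<in>ball x r.
        ((y - x) \<bullet> \<nu> < - e * norm (y - x) \<longrightarrow> y \<in> S) \<and>
        ((y - x) \<bullet> \<nu> > e * norm (y - x) \<longrightarrow> y \<notin> S))"

lemma is_outward_unit_normal_unique:
  assumes "is_outward_unit_normal S x \<nu>" and "is_outward_unit_normal S x \<nu>'"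
  shows "\<nu> = \<nu>'"
proof (rule ccontr)
  assume ne: "\<nu> \<noteq> \<nu>'"
  define w where "w = \<nu>' - \<nu>"
  have n: "\<nu> \<bullet> \<nu> = 1" "\<nu>' \<bullet> \<nu>' = 1"
    using assms by (auto simp: is_outward_unit_normal_def dot_square_norm)
  define c where "c = w \<bullet> \<nu>'"
  have w0: "norm w > 0" using ne by (simp add: w_def)
  have ww: "w \<bullet> w = 2 * c"
    using n by (simp add: c_def w_def inner_diff_left inner_diff_right inner_commute[of \<nu>' \<nu>])
  have "w \<bullet> w > 0" using ne by (simp add: w_def)
  then have c0: "c > 0" using ww by simp
  have wn: "w \<bullet> \<nu> = - c"
    using n by (simp add: c_def w_def inner_diff_left inner_commute[of \<nu>' \<nu>])
  define e where "e = c / (2 * norm w)"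
  have e0: "e > 0" using c0 w0 by (simp add: e_def)
  have ew: "e * norm w = c / 2" using w0 by (simp add: e_def)
  obtain r where r: "r > 0" "\<And>y. y \<in> ball x r \<Longrightarrow> (y - x) \<bullet> \<nu> < - e * norm (y - x) \<Longrightarrow> y \<in> S"
    using assms(1) e0 unfolding is_outward_unit_normal_def by metis
  obtain r' where r': "r' > 0" "\<And>y. y \<in> ball x r' \<Longrightarrow> (y - x) \<bullet> \<nu>' > e * norm (y - x) \<Longrightarrow> y \<notin> S"
    using assms(2) e0 unfolding is_outward_unit_normal_def by metis
  define s where "s = min r r' / (2 * norm w)"
  have s0: "s > 0" using r(1) r'(1) w0 by (simp add: s_def)
  have sw: "s * norm w = min r r' / 2" using w0 by (simp add: s_def)
  let ?y = "x + s *\<^sub>R w"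
  have "?y \<in> ball x r" "?y \<in> ball x r'"
    using s0 sw r(1) r'(1) by (auto simp: dist_norm)
  moreover have "(?y - x) \<bullet> \<nu> < - e * norm (?y - x)"
    using s0 c0 ew wn by (simp add: mult.left_commute[of e s])
  moreover have "(?y - x) \<bullet> \<nu>' > e * norm (?y - x)"
    using s0 c0 ew by (simp add: mult.left_commute[of e s] flip: c_def)
  ultimately show False using r(2) r'(2) by blast
qed

definition outward_normal :: "'a::euclidean_space set \<Rightarrow> 'a \<Rightarrow> 'a" where
  "outward_normal S x = (THE \<nu>. is_outward_unit_normal S x \<nu>)"

(* The gradient at a boundary point is the continuous extension of the gradient in S. *)
definition normal_derivative :: "'a::euclidean_space set \<Rightarrow> ('a \<Rightarrow> real) \<Rightarrow> 'a \<Rightarrow> real" where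
  "normal_derivative S g x = Lim (at x within S) (grad g) \<bullet> outward_normal S x"

(* A bounded domain on which the divergence theorem holds for all vector fields that are C^1
   up to the boundary. *)
definition divergence_theorem_domain :: "'a::euclidean_space set \<Rightarrow> bool" where
  "divergence_theorem_domain S \<longleftrightarrow>
     open S \<and> connected S \<and> bounded S \<and> S \<noteq> {} \<and>
     emeasure surface_measure (frontier S) < \<infinity> \<and>
     (AE x\<in>frontier S in surface_measure. \<exists>\<nu>. is_outward_unit_normal S x \<nu>) \<and>
     (\<forall>v. continuous_on (closure S) v \<and> (\<forall>b\<in>Basis. C_upto 1 S (closure S) (\<lambda>x. v x \<bullet> b)) \<longrightarrow>
        (LINT x:S|lborel. divergence v x) =
        (LINT x:frontier S|surface_measure. v x \<bullet> outward_normal S x))"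

definition F_pot :: "real \<Rightarrow> real" where
  "F_pot p = (p\<^sup>2 - 1)\<^sup>2 / 4"

definition f_pot :: "real \<Rightarrow> real" where
  "f_pot = deriv F_pot"

(* The N - 1 phase-field variables are the components of u :: real ^ 'd => real ^ 'n
   with CARD('n) = N - 1. *)
definition energy_part ::
    "('n::finite \<Rightarrow> real) \<Rightarrow> (real ^ 'd \<Rightarrow> real ^ 'n) \<Rightarrow> 'n \<Rightarrow> real ^ 'd \<Rightarrow> real" where
  "energy_part \<epsilon> u i x =
     \<epsilon> i / 2 * (norm (grad (\<lambda>y. u y $ i) x))\<^sup>2 + 1 / \<epsilon> i * F_pot (u x $ i)"

definition mixing_energy ::
    "(real ^ 'd) set \<Rightarrow> ('n::finite \<Rightarrow> real) \<Rightarrow> ('n \<Rightarrow> real ^ 'n \<Rightarrow> real) \<Rightarrow>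
     (real ^ 'd \<Rightarrow> real ^ 'n) \<Rightarrow> real" where
  "mixing_energy \<Omega> \<epsilon> \<gamma> u =
     (LINT x:\<Omega>|lborel. \<Sum>i\<in>UNIV. \<gamma> i (u x) * energy_part \<epsilon> u i x)"

definition cahn_hilliard_system ::
    "(real ^ 'd) set \<Rightarrow> real set \<Rightarrow> ('n::finite \<Rightarrow> real) \<Rightarrow> ('n \<Rightarrow> real ^ 'n \<Rightarrow> real) \<Rightarrow>
     ('n \<Rightarrow> real ^ 'n \<Rightarrow> real) \<Rightarrow> (real ^ 'd \<Rightarrow> real \<Rightarrow> real ^ 'n) \<Rightarrow>
     (real ^ 'd \<Rightarrow> real \<Rightarrow> real ^ 'n) \<Rightarrow> bool" where
  "cahn_hilliard_system \<Omega> I \<epsilon> \<gamma> M \<Phi> \<mu> \<longleftrightarrow>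
     (\<forall>t\<in>I. \<forall>i.
       (\<forall>x\<in>\<Omega>.
          deriv (\<lambda>s. \<Phi> x s $ i) t =
            divergence (\<lambda>y. M i (\<Phi> y t) *\<^sub>R grad (\<lambda>z. \<mu> z t $ i) y) x \<and>
          \<mu> x t $ i =
            - \<epsilon> i * divergence (\<lambda>y. \<gamma> i (\<Phi> y t) *\<^sub>R grad (\<lambda>z. \<Phi> z t $ i) y) x
            + 1 / \<epsilon> i * \<gamma> i (\<Phi> x t) * f_pot (\<Phi> x t $ i)
            + (\<Sum>j\<in>UNIV. partial_deriv i (\<gamma> j) (\<Phi> x t) * energy_part \<epsilon> (\<lambda>y. \<Phi> y t) j x)) \<and>
       (AE x\<in>frontier \<Omega> in surface_measure.
          normal_derivative \<Omega> (\<lambda>y. \<Phi> y t $ i) x = 0 \<and>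
          normal_derivative \<Omega> (\<lambda>y. \<mu> y t $ i) x = 0))"

(* \<Phi> is C^2 in (x, t) and \<mu> is C^2 in x at each time, both up to the boundary in x. *)
definition sufficiently_smooth ::
    "(real ^ 'd) set \<Rightarrow> real set \<Rightarrow> (real ^ 'd \<Rightarrow> real \<Rightarrow> real ^ 'n) \<Rightarrow>
     (real ^ 'd \<Rightarrow> real \<Rightarrow> real ^ 'n) \<Rightarrow> bool" where
  "sufficiently_smooth \<Omega> I \<Phi> \<mu> \<longleftrightarrow>
     (\<forall>i. C_upto 2 (\<Omega> \<times> I) (closure \<Omega> \<times> I) (\<lambda>(x, t). \<Phi> x t $ i)) \<and>
     (\<forall>i. \<forall>t\<in>I. C_upto 2 \<Omega> (closure \<Omega>) (\<lambda>x. \<mu> x t $ i))"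

end

(* Differentiate the energy under the integral sign and exchange the time and space derivatives.
   Testing the i-th potential equation with the time derivative of phi_i, the divergence theorem and
   the Neumann condition for phi_i give dW/dt = integral of sum_i mu_i * d phi_i/dt.  Inserting the
   evolution equation and integrating by parts once more, with the Neumann condition for mu_i, gives
   minus the dissipation. *)
theory Submission imports Defs begin

text \<open>The obstacle is the boundary. Membership in \<open>C_upto\<close> ignores values off the
  open set and only asserts that continuous extensions exist, while the divergence theorem needs a
  field that is continuous on the closure and \<open>normal_derivative\<close> is a limit of
  interior gradients. Boundary terms are therefore computed with fields assembled from these
  extensions. Orders 0 and 1 carry most of the work: integrands may contain second derivatives and
  need only be continuous up to the boundary, whereas the fields whose divergence is integrated, and
  the energy density in space-time, must be C^1. Joint C^2 regularity of the phase fields makes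
  their time derivatives C^1, hence admissible test functions. The integrations by parts are
  packaged as two expressions \<open>A\<close> and \<open>B\<close> with vanishing integral. The
  time derivative of the energy density equals the sum of
  \<open>\<epsilon> i * A i x + B i x - D i x\<close> at every interior point, with \<open>D\<close>
  the dissipation density, so the energy law follows from this identity by linearity of the
  integral.\<close>

section \<open>Elementary rules for the classes C^k up to the boundary\<close>

lemma C_upto_SucD:
  assumes "C_upto (Suc k) S T g"
  shows "C_upto 0 S T g"
    and "x \<in> S \<Longrightarrow> g differentiable (at x)"
    and "b \<in> Basis \<Longrightarrow> C_upto k S T (\<lambda>x. frechet_derivative g (at x) b)"
  using assms by auto

lemma C_upto_SucI:
  assumes "C_upto 0 S T g"
    and "\<And>x. x \<in> S \<Longrightarrow> g differentiable (at x)"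
    and "\<And>b. b \<in> Basis \<Longrightarrow> C_upto k S T (\<lambda>x. frechet_derivative g (at x) b)"
  shows "C_upto (Suc k) S T g"
  using assms by auto

lemma C_upto_0I: "continuous_on T h \<Longrightarrow> (\<And>x. x \<in> S \<Longrightarrow> h x = g x) \<Longrightarrow> C_upto 0 S T g"
  by auto

lemma C_upto_0E:
  assumes "C_upto 0 S T g"
  obtains h where "continuous_on T h" "\<And>x. x \<in> S \<Longrightarrow> h x = g x"
  using assms by auto

lemma C_upto_imp_0: "C_upto k S T g \<Longrightarrow> C_upto 0 S T g"
  by (cases k) auto

declare C_upto.simps [simp del]

lemma C_upto_Suc_imp: "C_upto (Suc k) S T g \<Longrightarrow> C_upto k S T g"
proof (induction k arbitrary: g)
  case 0
  then show ?case by (rule C_upto_SucD(1))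
next
  case (Suc k)
  show ?case
    by (rule C_upto_SucI[OF C_upto_SucD(1,2)[OF Suc.prems] Suc.IH[OF C_upto_SucD(3)[OF Suc.prems]]])
qed

text \<open>On an open set, equal functions have equal derivatives, and the extensions refer to
  values on \<open>S\<close> only, so the property passes along by induction on the order. This
  allows a derivative to be replaced by an explicit formula valid on \<open>S\<close> alone.\<close>

lemma C_upto_cong:
  assumes "open S" and "\<And>x. x \<in> S \<Longrightarrow> f x = g x" and "C_upto k S T f"
  shows "C_upto k S T g"
  using assms(2,3)
proof (induction k arbitrary: f g)
  case 0
  obtain h where "continuous_on T h" "\<And>x. x \<in> S \<Longrightarrow> h x = f x"
    using 0(2) by (metis C_upto_0E)
  then show ?case using 0 by (intro C_upto_0I[of T h]) auto
next
  case (Suc k)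
  have der: "(g has_derivative frechet_derivative f (at x)) (at x)" if "x \<in> S" for x
    using has_derivative_transform_within_open[OF _ \<open>open S\<close> that, of f] that
      C_upto_SucD(2)[OF Suc.prems(2) that] Suc.prems(1)
    by (auto simp: frechet_derivative_works)
  note D = C_upto_SucD[OF Suc.prems(2)]
  obtain h where "continuous_on T h" "\<And>x. x \<in> S \<Longrightarrow> h x = f x"
    using D(1) by (metis C_upto_0E)
  then have "C_upto 0 S T g" using Suc.prems(1) by (intro C_upto_0I[of T h]) auto
  moreover have "C_upto k S T (\<lambda>x. frechet_derivative g (at x) b)" if "b \<in> Basis" for b
    by (rule Suc.IH[OF _ D(3)[OF that]]) (simp add: frechet_derivative_at[OF der])
  ultimately show ?case
    using der by (intro C_upto_SucI) (auto simp: differentiable_def)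
qed

section \<open>Algebra of the classes of order 0 and 1\<close>

lemma C_upto_0_const: "C_upto 0 S T (\<lambda>x. c)"
  by (rule C_upto_0I[of _ "\<lambda>x. c"]) auto

lemma C_upto_0_add:
  assumes "C_upto 0 S T f" "C_upto 0 S T g"
  shows "C_upto 0 S T (\<lambda>x. f x + g x)"
proof -
  obtain h k where "continuous_on T h" "\<And>x. x \<in> S \<Longrightarrow> h x = f x"
      "continuous_on T k" "\<And>x. x \<in> S \<Longrightarrow> k x = g x"
    using assms by (metis C_upto_0E)
  then show ?thesis
    by (intro C_upto_0I[of _ "\<lambda>x. h x + k x"]) (auto intro: continuous_intros)
qed

lemma C_upto_0_mult:
  assumes "C_upto 0 S T f" "C_upto 0 S T g"
  shows "C_upto 0 S T (\<lambda>x. f x * g x)"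
proof -
  obtain h k where "continuous_on T h" "\<And>x. x \<in> S \<Longrightarrow> h x = f x"
      "continuous_on T k" "\<And>x. x \<in> S \<Longrightarrow> k x = g x"
    using assms by (metis C_upto_0E)
  then show ?thesis
    by (intro C_upto_0I[of _ "\<lambda>x. h x * k x"]) (auto intro: continuous_intros)
qed

lemma C_upto_0_sum:
  assumes "\<And>i. i \<in> A \<Longrightarrow> C_upto 0 S T (f i)"
  shows "C_upto 0 S T (\<lambda>x. \<Sum>i\<in>A. f i x)"
  using assms
  by (induction A rule: infinite_finite_induct) (auto intro: C_upto_0_const C_upto_0_add)

text \<open>The extension of the composite is \<open>g\<close> applied to the vector of extended
  components. Continuity of \<open>g\<close> is required on the whole space because the extended
  components may take arbitrary values on the part of \<open>T\<close> outside
  \<open>S\<close>.\<close>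

lemma C_upto_0_compose:
  fixes u :: "'a::euclidean_space \<Rightarrow> real ^ 'n"
  assumes "\<And>i. C_upto 0 S T (\<lambda>x. u x $ i)" "continuous_on UNIV g"
  shows "C_upto 0 S T (\<lambda>x. g (u x))"
proof -
  have "\<exists>h. continuous_on T h \<and> (\<forall>x\<in>S. h x = u x $ i)" for i
    using assms(1)[of i] by (metis C_upto_0E)
  then obtain h where h: "\<And>i. continuous_on T (h i)" "\<And>i x. x \<in> S \<Longrightarrow> h i x = u x $ i"
    by metis
  have "continuous_on T (\<lambda>x. \<chi> i. h i x)"
    using h(1) by (rule continuous_on_vec_lambda)
  from continuous_on_compose2[OF assms(2) this]
  have "continuous_on T (\<lambda>x. g (\<chi> i. h i x))" by simp
  have "(\<chi> i. h i x) = u x" if "x \<in> S" for x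
    using h(2)[OF that] by (simp add: vec_eq_iff)
  with \<open>continuous_on T (\<lambda>x. g (\<chi> i. h i x))\<close> show ?thesis
    by (intro C_upto_0I[of T "\<lambda>x. g (\<chi> i. h i x)"]) auto
qed

lemma has_derivative_frechet_derivative:
  "g differentiable (at x) \<Longrightarrow> (g has_derivative frechet_derivative g (at x)) (at x)"
  by (simp add: frechet_derivative_works)

text \<open>Derivatives are unique, so any explicitly known derivative \<open>g'\<close> agrees with
  \<open>frechet_derivative\<close> on \<open>S\<close>. The sum, product and chain rules then yield
  membership in the class without computing \<open>frechet_derivative\<close> each time.\<close>

lemma C_upto_Suc0_hasI:
  assumes "C_upto 0 S T g"
    and der: "\<And>x. x \<in> S \<Longrightarrow> (g has_derivative g' x) (at x)"
    and "\<And>b. b \<in> Basis \<Longrightarrow> C_upto 0 S T (\<lambda>x. g' x b)"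
    and "open S"
  shows "C_upto (Suc 0) S T g"
proof (rule C_upto_SucI)
  show "C_upto 0 S T (\<lambda>x. frechet_derivative g (at x) b)" if "b \<in> Basis" for b
    by (rule C_upto_cong[OF \<open>open S\<close> _ assms(3)[OF that]])
      (simp flip: frechet_derivative_at[OF der])
qed (use assms in \<open>auto simp: differentiable_def\<close>)

lemma C_upto_Suc0_const: "open S \<Longrightarrow> C_upto (Suc 0) S T (\<lambda>x. c)"
  by (rule C_upto_Suc0_hasI[where g' = "\<lambda>x h. 0"]) (auto intro: C_upto_0_const)

lemma C_upto_Suc0_add:
  assumes "C_upto (Suc 0) S T f" "C_upto (Suc 0) S T g" "open S"
  shows "C_upto (Suc 0) S T (\<lambda>x. f x + g x)"
proof -
  note A = C_upto_SucD[OF assms(1)] and B = C_upto_SucD[OF assms(2)]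
  show ?thesis
    by (rule C_upto_Suc0_hasI[OF C_upto_0_add[OF A(1) B(1)]
        has_derivative_add[OF A(2)[THEN has_derivative_frechet_derivative] B(2)[THEN has_derivative_frechet_derivative]]
        _ \<open>open S\<close>])
      (assumption | intro C_upto_0_add C_upto_0_mult A(1,3) B(1,3))+
qed

lemma C_upto_Suc0_mult:
  assumes "C_upto (Suc 0) S T f" "C_upto (Suc 0) S T g" "open S"
  shows "C_upto (Suc 0) S T (\<lambda>x. f x * g x)"
proof -
  note A = C_upto_SucD[OF assms(1)] and B = C_upto_SucD[OF assms(2)]
  show ?thesis
    by (rule C_upto_Suc0_hasI[OF C_upto_0_mult[OF A(1) B(1)]
        has_derivative_mult[OF A(2)[THEN has_derivative_frechet_derivative] B(2)[THEN has_derivative_frechet_derivative]]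
        _ \<open>open S\<close>])
      (assumption | intro C_upto_0_add C_upto_0_mult A(1,3) B(1,3))+
qed

lemma C_upto_Suc0_sum:
  assumes "\<And>i. i \<in> A \<Longrightarrow> C_upto (Suc 0) S T (f i)" "open S"
  shows "C_upto (Suc 0) S T (\<lambda>x. \<Sum>i\<in>A. f i x)"
  using assms
  by (induction A rule: infinite_finite_induct) (auto intro: C_upto_Suc0_const C_upto_Suc0_add)

section \<open>Functions smooth on the whole space and their composition with C^1 maps\<close>

lemma C_upto_0_UNIV_iff: "C_upto 0 UNIV UNIV g \<longleftrightarrow> continuous_on UNIV g"
proof
  assume "C_upto 0 UNIV UNIV g"
  then obtain h where "continuous_on UNIV h" "\<And>x. x \<in> UNIV \<Longrightarrow> h x = g x"
    by (metis C_upto_0E)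
  moreover from this have "h = g" by auto
  ultimately show "continuous_on UNIV g" by simp
qed (auto intro: C_upto_0I)

lemma smooth_differentiable: "smooth g \<Longrightarrow> g differentiable (at x)"
  using C_upto_SucD(2)[of 0 UNIV UNIV g x] by (simp add: smooth_def)

lemma frechet_derivative_partial_deriv:
  assumes "g differentiable (at u)"
  shows "frechet_derivative g (at u) v = (\<Sum>i\<in>UNIV. partial_deriv i g u * v $ i)"
proof -
  interpret linear "frechet_derivative g (at u)"
    using assms by (rule linear_frechet_derivative)
  have "v = (\<Sum>i\<in>UNIV. v $ i *\<^sub>R axis i 1)"
    by (simp add: vec_eq_iff axis_def if_distrib cong: if_cong)
  then have "frechet_derivative g (at u) v = frechet_derivative g (at u) (\<Sum>i\<in>UNIV. v $ i *\<^sub>R axis i 1)"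
    by simp
  also have "\<dots> = (\<Sum>i\<in>UNIV. partial_deriv i g u * v $ i)"
    by (simp add: sum scale partial_deriv_def mult.commute)
  finally show ?thesis .
qed

lemma has_derivative_smooth_compose:
  fixes u :: "'a::euclidean_space \<Rightarrow> real ^ 'n"
  assumes "smooth g" and "\<And>i. ((\<lambda>x. u x $ i) has_derivative u' i) (at x)"
  shows "((\<lambda>x. g (u x)) has_derivative (\<lambda>h. \<Sum>i\<in>UNIV. partial_deriv i g (u x) * u' i h)) (at x)"
proof -
  have "(u has_derivative (\<lambda>h. \<chi> i. u' i h)) (at x)"
    unfolding has_derivative_componentwise_within[of u]
    using assms(2) by (auto simp: Basis_vec_def cart_eq_inner_axis[symmetric])
  from has_derivative_compose[OF this has_derivative_frechet_derivative[OF smooth_differentiable[OF assms(1)]]]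
  show ?thesis
    by (simp add: frechet_derivative_partial_deriv[OF smooth_differentiable[OF assms(1)]])
qed

lemma continuous_on_smooth:
  assumes "smooth g"
  shows "continuous_on UNIV g" "continuous_on UNIV (partial_deriv i g)"
proof -
  have *: "C_upto (Suc 0) UNIV UNIV g" using assms by (simp add: smooth_def)
  show "continuous_on UNIV g" using C_upto_SucD(1)[OF *] by (simp add: C_upto_0_UNIV_iff)
  have "axis i 1 \<in> (Basis :: (real ^ _) set)" by simp
  from C_upto_SucD(3)[OF * this] show "continuous_on UNIV (partial_deriv i g)"
    by (simp add: C_upto_0_UNIV_iff partial_deriv_def[abs_def])
qed

text \<open>The chain rule writes each directional derivative as a finite sum of products of
  functions of class C^0. It applies to the surface tensions and mobilities evaluated along the
  phase fields.\<close>

lemma C_upto_Suc0_smooth_compose: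
  fixes u :: "'a::euclidean_space \<Rightarrow> real ^ 'n"
  assumes "smooth g" and u: "\<And>i. C_upto (Suc 0) S T (\<lambda>x. u x $ i)" and "open S"
  shows "C_upto (Suc 0) S T (\<lambda>x. g (u x))"
proof -
  have 0: "C_upto 0 S T (\<lambda>x. g (u x))"
    using u[THEN C_upto_imp_0] continuous_on_smooth(1)[OF assms(1)] by (rule C_upto_0_compose)
  have der: "((\<lambda>x. g (u x)) has_derivative
      (\<lambda>h. \<Sum>i\<in>UNIV. partial_deriv i g (u x) * frechet_derivative (\<lambda>x. u x $ i) (at x) h)) (at x)"
    if "x \<in> S" for x
    using has_derivative_frechet_derivative[OF C_upto_SucD(2)[OF u that]]
    by (rule has_derivative_smooth_compose[OF assms(1)])
  have "C_upto 0 S T (\<lambda>x. partial_deriv i g (u x))" for i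
    using u[THEN C_upto_imp_0] continuous_on_smooth(2)[OF assms(1)] by (rule C_upto_0_compose)
  then have "C_upto 0 S T (\<lambda>x. partial_deriv i g (u x) * frechet_derivative (\<lambda>x. u x $ i) (at x) b)"
    if "b \<in> Basis" for b i
    by (rule C_upto_0_mult[OF _ C_upto_SucD(3)[OF u that]])
  then have basis: "C_upto 0 S T (\<lambda>x. \<Sum>i\<in>UNIV. partial_deriv i g (u x) * frechet_derivative (\<lambda>x. u x $ i) (at x) b)"
    if "b \<in> Basis" for b
    using that by (intro C_upto_0_sum)
  show ?thesis
    by (rule C_upto_Suc0_hasI[OF 0 der basis \<open>open S\<close>])
qed

section \<open>Restriction of space-time functions to a fixed time or a fixed point\<close>

lemma has_derivative_slice_fst:
  fixes G :: "'a::real_normed_vector \<times> real \<Rightarrow> real"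
  assumes "G differentiable (at (x, t))"
  shows "((\<lambda>y. G (y, t)) has_derivative (\<lambda>v. frechet_derivative G (at (x, t)) (v, 0))) (at x)"
  by (rule has_derivative_compose[where f = "\<lambda>y. (y, t)" and g = G,
        OF has_derivative_Pair[OF has_derivative_ident has_derivative_const]
          has_derivative_frechet_derivative[OF assms]])

lemma frechet_derivative_slice:
  fixes G :: "'a::real_normed_vector \<times> real \<Rightarrow> real"
  assumes "G differentiable (at (x, t))"
  shows "frechet_derivative (\<lambda>y. G (y, t)) (at x) b = frechet_derivative G (at (x, t)) (b, 0)"
  by (rule fun_cong[OF frechet_derivative_at[OF has_derivative_slice_fst[OF assms]], symmetric])

lemma has_real_derivative_slice:
  fixes G :: "'a::real_normed_vector \<times> real \<Rightarrow> real"
  assumes "G differentiable (at (x, t))"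
  shows "((\<lambda>s. G (x, s)) has_real_derivative frechet_derivative G (at (x, t)) (0, 1)) (at t)"
proof -
  interpret linear "frechet_derivative G (at (x, t))"
    using assms by (rule linear_frechet_derivative)
  have "((\<lambda>s. G (x, s)) has_derivative (\<lambda>h. frechet_derivative G (at (x, t)) (0, h))) (at t)"
    by (rule has_derivative_compose[where f = "\<lambda>s. (x, s)" and g = G,
          OF has_derivative_Pair[OF has_derivative_const has_derivative_ident]
            has_derivative_frechet_derivative[OF assms]])
  moreover have "(\<lambda>h. frechet_derivative G (at (x, t)) (0, h)) = (*) (frechet_derivative G (at (x, t)) (0, 1))"
  proof
    show "frechet_derivative G (at (x, t)) (0, h) = frechet_derivative G (at (x, t)) (0, 1) * h" for h
      using scale[of h "(0, 1)"] by simp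
  qed
  ultimately show ?thesis
    by (simp only: has_field_derivative_def)
qed

text \<open>A spatial basis vector \<open>b\<close> corresponds to the basis vector
  \<open>(b, 0)\<close> of space-time, so the induction hypothesis applied to the derivative of
  \<open>G\<close> in that direction covers the derivative of the slice. Fixing \<open>t\<close> in
  the extension gives the extension of the slice.\<close>

lemma C_upto_slice:
  fixes G :: "'a::euclidean_space \<times> real \<Rightarrow> real"
  assumes "open S" "open I" "t \<in> I" "C_upto k (S \<times> I) (T \<times> I) G"
  shows "C_upto k S T (\<lambda>x. G (x, t))"
  using assms(4)
proof (induction k arbitrary: G)
  case 0
  then obtain h where h: "continuous_on (T \<times> I) h" "\<And>z. z \<in> S \<times> I \<Longrightarrow> h z = G z"
    by (metis C_upto_0E)
  have "continuous_on T (\<lambda>x. h (x, t))"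
    by (rule continuous_on_compose2[OF h(1) continuous_on_Pair[OF continuous_on_id continuous_on_const]])
      (use \<open>t \<in> I\<close> in auto)
  then show ?case
    using \<open>t \<in> I\<close> h(2) by (intro C_upto_0I[of T "\<lambda>x. h (x, t)"]) auto
next
  case (Suc k)
  note D = C_upto_SucD[OF Suc.prems]
  have diff: "G differentiable (at (x, t))" if "x \<in> S" for x
    using D(2) that \<open>t \<in> I\<close> by simp
  show ?case
  proof (rule C_upto_SucI)
    show "C_upto 0 S T (\<lambda>x. G (x, t))"
      by (rule C_upto_imp_0[OF Suc.IH[OF C_upto_Suc_imp[OF Suc.prems]]])
    show "C_upto k S T (\<lambda>x. frechet_derivative (\<lambda>x. G (x, t)) (at x) b)" if "b \<in> Basis" for b
    proof (rule C_upto_cong[OF \<open>open S\<close>])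
      have "(b, 0) \<in> (Basis :: ('a \<times> real) set)" using that by (simp add: Basis_prod_def)
      from Suc.IH[OF D(3)[OF this]]
      show "C_upto k S T (\<lambda>x. frechet_derivative G (at (x, t)) (b, 0))" .
    qed (simp add: frechet_derivative_slice diff)
    show "(\<lambda>x. G (x, t)) differentiable (at x)" if "x \<in> S" for x
      using has_derivative_slice_fst[OF diff[OF that]] by (rule differentiableI)
  qed
qed

section \<open>Symmetry of mixed derivatives\<close>

lemma has_real_derivative_line:
  fixes F :: "'a::real_normed_vector \<Rightarrow> real"
  assumes "F differentiable (at (p + r *\<^sub>R v))"
  shows "((\<lambda>r. F (p + r *\<^sub>R v)) has_real_derivative frechet_derivative F (at (p + r *\<^sub>R v)) v) (at r)"
proof -
  let ?D = "frechet_derivative F (at (p + r *\<^sub>R v))"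
  have "((\<lambda>r. p + r *\<^sub>R v) has_derivative (\<lambda>h. h *\<^sub>R v)) (at r)"
    by (auto intro!: derivative_eq_intros)
  from has_derivative_compose[OF this has_derivative_frechet_derivative[OF assms]]
  have *: "((\<lambda>r. F (p + r *\<^sub>R v)) has_derivative (\<lambda>h. ?D (h *\<^sub>R v))) (at r)" .
  have "(\<lambda>h. ?D (h *\<^sub>R v)) = (*) (?D v)"
    using linear_frechet_derivative[OF assms] by (auto simp: linear_scale fun_eq_iff)
  with * show ?thesis by (simp only: has_field_derivative_def)
qed

text \<open>The second difference is the increment over \<open>{0..h}\<close> of the function of
  \<open>s\<close> that compares \<open>g\<close> on two parallel segments in direction
  \<open>a\<close>. The mean value theorem gives one factor \<open>h\<close> and a difference of
  derivatives along \<open>a\<close>; a second application, now in direction \<open>b\<close>, gives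
  the other factor.\<close>

lemma mixed_difference_mvt:
  fixes g :: "'a::real_normed_vector \<Rightarrow> real"
  assumes "h > 0"
    and g: "\<And>s r. s \<in> {0..h} \<Longrightarrow> r \<in> {0..h} \<Longrightarrow> g differentiable (at (x + s *\<^sub>R a + r *\<^sub>R b))"
    and ga: "\<And>s r. s \<in> {0..h} \<Longrightarrow> r \<in> {0..h} \<Longrightarrow>
      (\<lambda>y. frechet_derivative g (at y) a) differentiable (at (x + s *\<^sub>R a + r *\<^sub>R b))"
  obtains s r where "s \<in> {0..h}" "r \<in> {0..h}"
    "g (x + h *\<^sub>R a + h *\<^sub>R b) - g (x + h *\<^sub>R a) - g (x + h *\<^sub>R b) + g x =
      h\<^sup>2 * frechet_derivative (\<lambda>y. frechet_derivative g (at y) a) (at (x + s *\<^sub>R a + r *\<^sub>R b)) b"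
proof -
  let ?ga = "\<lambda>y. frechet_derivative g (at y) a"
  have "((\<lambda>s. g ((x + r *\<^sub>R b) + s *\<^sub>R a)) has_real_derivative ?ga (x + s *\<^sub>R a + r *\<^sub>R b)) (at s)"
    if "s \<in> {0..h}" "r \<in> {0..h}" for s r
    using has_real_derivative_line[of g "x + r *\<^sub>R b" s a] g[OF that] by (simp add: add_ac)
  from DERIV_diff[OF this[of _ h] this[of _ 0]]
  have line: "((\<lambda>s. g (x + h *\<^sub>R b + s *\<^sub>R a) - g (x + s *\<^sub>R a)) has_real_derivative
      ?ga (x + s *\<^sub>R a + h *\<^sub>R b) - ?ga (x + s *\<^sub>R a)) (at s)" if "s \<in> {0..h}" for s
    using that \<open>h > 0\<close> by simp
  have "\<exists>s>0. s < h \<and> (g (x + h *\<^sub>R b + h *\<^sub>R a) - g (x + h *\<^sub>R a)) - (g (x + h *\<^sub>R b + 0 *\<^sub>R a) - g (x + 0 *\<^sub>R a))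
      = (h - 0) * (?ga (x + s *\<^sub>R a + h *\<^sub>R b) - ?ga (x + s *\<^sub>R a))"
    by (rule MVT2) (use \<open>h > 0\<close> line in auto)
  then obtain s where s: "0 < s" "s < h"
    "g (x + h *\<^sub>R a + h *\<^sub>R b) - g (x + h *\<^sub>R a) - g (x + h *\<^sub>R b) + g x
      = h * (?ga (x + s *\<^sub>R a + h *\<^sub>R b) - ?ga (x + s *\<^sub>R a))"
    by (auto simp: algebra_simps)
  have "\<exists>r>0. r < h \<and> ?ga (x + s *\<^sub>R a + h *\<^sub>R b) - ?ga (x + s *\<^sub>R a + 0 *\<^sub>R b)
      = (h - 0) * frechet_derivative ?ga (at (x + s *\<^sub>R a + r *\<^sub>R b)) b"
    by (rule MVT2) (use \<open>h > 0\<close> s in \<open>auto intro!: has_real_derivative_line ga\<close>)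
  then obtain r where "0 < r" "r < h"
    "?ga (x + s *\<^sub>R a + h *\<^sub>R b) - ?ga (x + s *\<^sub>R a)
      = h * frechet_derivative ?ga (at (x + s *\<^sub>R a + r *\<^sub>R b)) b"
    by auto
  with s show ?thesis
    by (intro that[of s r]) (auto simp: power2_eq_square)
qed

lemma mixed_derivatives_commute:
  fixes g :: "'a::real_normed_vector \<Rightarrow> real"
  assumes "open S" "x \<in> S"
    and g: "\<And>y. y \<in> S \<Longrightarrow> g differentiable (at y)"
    and ga: "\<And>y. y \<in> S \<Longrightarrow> (\<lambda>y. frechet_derivative g (at y) a) differentiable (at y)"
    and gb: "\<And>y. y \<in> S \<Longrightarrow> (\<lambda>y. frechet_derivative g (at y) b) differentiable (at y)"
    and "continuous_on S (\<lambda>y. frechet_derivative (\<lambda>y. frechet_derivative g (at y) a) (at y) b)"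
    and "continuous_on S (\<lambda>y. frechet_derivative (\<lambda>y. frechet_derivative g (at y) b) (at y) a)"
  shows "frechet_derivative (\<lambda>y. frechet_derivative g (at y) a) (at x) b =
    frechet_derivative (\<lambda>y. frechet_derivative g (at y) b) (at x) a"
proof (rule ccontr)
  \<comment> \<open>The second difference of \<open>g\<close> over a small parallelogram equals both mixed derivatives at
    nearby points, up to the factor \<open>h\<^sup>2\<close>.\<close>
  define P where "P = (\<lambda>y. frechet_derivative (\<lambda>y. frechet_derivative g (at y) a) (at y) b)"
  define Q where "Q = (\<lambda>y. frechet_derivative (\<lambda>y. frechet_derivative g (at y) b) (at y) a)"
  assume "\<not> ?thesis"
  \<comment> \<open>Half the gap between the two mixed derivatives is the tolerance: two values
    strictly closer than this to \<open>P x\<close> and to \<open>Q x\<close> respectively cannot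
    coincide.\<close>
  then have "\<bar>P x - Q x\<bar> / 2 > 0" by (simp add: P_def Q_def)
  moreover have "isCont P x" "isCont Q x"
    using assms by (auto simp: P_def Q_def continuous_on_eq_continuous_at)
  ultimately obtain d1 d2 where d12: "d1 > 0" "\<And>y. dist y x < d1 \<Longrightarrow> \<bar>P y - P x\<bar> < \<bar>P x - Q x\<bar> / 2"
    "d2 > 0" "\<And>y. dist y x < d2 \<Longrightarrow> \<bar>Q y - Q x\<bar> < \<bar>P x - Q x\<bar> / 2"
    unfolding continuous_at_eps_delta dist_real_def by metis
  obtain d3 where d3: "d3 > 0" "\<And>y. dist y x < d3 \<Longrightarrow> y \<in> S"
    using assms(1,2) by (metis open_dist)
  define d where "d = min d1 (min d2 d3)"
  have "d > 0" using d12 d3 by (simp add: d_def)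
  \<comment> \<open>Every point of the parallelogram with sides \<open>h *\<^sub>R a\<close> and
    \<open>h *\<^sub>R b\<close> at \<open>x\<close> lies within \<open>h * K\<close> of
    \<open>x\<close>, and \<open>h\<close> is chosen so that this is \<open>d / 2\<close>. The
    summand 1 keeps \<open>K\<close> positive when both vectors vanish.\<close>
  define K where "K = norm a + norm b + 1"
  have "K > 0" by (simp add: K_def add_nonneg_pos)
  define h where "h = d / (2 * K)"
  have "h > 0" using \<open>d > 0\<close> \<open>K > 0\<close> by (simp add: h_def)
  have near: "dist (x + s *\<^sub>R a + r *\<^sub>R b) x < d" if "s \<in> {0..h}" "r \<in> {0..h}" for s r
  proof -
    have "dist (x + s *\<^sub>R a + r *\<^sub>R b) x = norm (s *\<^sub>R a + r *\<^sub>R b)"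
      by (simp add: dist_norm algebra_simps)
    also have "\<dots> \<le> s * norm a + r * norm b"
      using that by (intro norm_triangle_le) auto
    also have "\<dots> \<le> h * norm a + h * norm b"
      using that by (intro add_mono mult_right_mono) auto
    also have "\<dots> \<le> h * K"
      using \<open>h > 0\<close> by (simp add: K_def algebra_simps)
    also have "\<dots> < d"
      using \<open>K > 0\<close> \<open>d > 0\<close> by (simp add: h_def)
    finally show ?thesis .
  qed
  then have near': "dist (x + r *\<^sub>R b + s *\<^sub>R a) x < d" if "s \<in> {0..h}" "r \<in> {0..h}" for s r
    using near[OF that] by (simp add: add_ac)
  have S: "x + s *\<^sub>R a + r *\<^sub>R b \<in> S" "x + r *\<^sub>R b + s *\<^sub>R a \<in> S"
    if "s \<in> {0..h}" "r \<in> {0..h}" for s r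
    using near[OF that] near'[OF that] d3(2) by (auto simp: d_def)
  obtain s r where sr: "s \<in> {0..h}" "r \<in> {0..h}"
    "g (x + h *\<^sub>R a + h *\<^sub>R b) - g (x + h *\<^sub>R a) - g (x + h *\<^sub>R b) + g x =
      h\<^sup>2 * P (x + s *\<^sub>R a + r *\<^sub>R b)"
    unfolding P_def using mixed_difference_mvt[OF \<open>h > 0\<close> g[OF S(1)] ga[OF S(1)]] by blast
  obtain r' s' where rs: "r' \<in> {0..h}" "s' \<in> {0..h}"
    "g (x + h *\<^sub>R b + h *\<^sub>R a) - g (x + h *\<^sub>R b) - g (x + h *\<^sub>R a) + g x =
      h\<^sup>2 * Q (x + r' *\<^sub>R b + s' *\<^sub>R a)"
    unfolding Q_def
    using mixed_difference_mvt[OF \<open>h > 0\<close>, of g x b a] g[OF S(2)] gb[OF S(2)] by blast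
  \<comment> \<open>The second difference is symmetric in \<open>a\<close> and \<open>b\<close>, so
    the two mean value formulas describe the same number.\<close>
  have "h\<^sup>2 * P (x + s *\<^sub>R a + r *\<^sub>R b) = h\<^sup>2 * Q (x + r' *\<^sub>R b + s' *\<^sub>R a)"
    using sr(3) rs(3) unfolding add.assoc add.commute[of "h *\<^sub>R b" "h *\<^sub>R a"] by linarith
  then have "P (x + s *\<^sub>R a + r *\<^sub>R b) = Q (x + r' *\<^sub>R b + s' *\<^sub>R a)"
    using \<open>h > 0\<close> by simp
  moreover have "\<bar>P (x + s *\<^sub>R a + r *\<^sub>R b) - P x\<bar> < \<bar>P x - Q x\<bar> / 2"
    using near[OF sr(1,2)] by (intro d12) (simp add: d_def)
  moreover have "\<bar>Q (x + r' *\<^sub>R b + s' *\<^sub>R a) - Q x\<bar> < \<bar>P x - Q x\<bar> / 2"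
    using near'[OF rs(2,1)] by (intro d12) (simp add: d_def)
  ultimately show False by (simp add: abs_if split: if_splits)
qed

lemma C_upto_0_continuous_on:
  assumes "C_upto 0 S T g" "S \<subseteq> T"
  shows "continuous_on S g"
  using assms by (metis C_upto_0E continuous_on_cong continuous_on_subset)

lemma C_upto_2_mixed_derivatives_commute:
  assumes g: "C_upto 2 S T g" and "open S" "S \<subseteq> T" "x \<in> S" "a \<in> Basis" "b \<in> Basis"
  shows "frechet_derivative (\<lambda>y. frechet_derivative g (at y) a) (at x) b =
    frechet_derivative (\<lambda>y. frechet_derivative g (at y) b) (at x) a"
proof -
  note g = g[unfolded numeral_2_eq_2]
  note ga = C_upto_SucD(3)[OF g \<open>a \<in> Basis\<close>] and gb = C_upto_SucD(3)[OF g \<open>b \<in> Basis\<close>]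
  show ?thesis
    by (rule mixed_derivatives_commute[OF assms(2,4) C_upto_SucD(2)[OF g] C_upto_SucD(2)[OF ga]
          C_upto_SucD(2)[OF gb] C_upto_0_continuous_on[OF C_upto_SucD(3)[OF ga \<open>b \<in> Basis\<close>] \<open>S \<subseteq> T\<close>]
          C_upto_0_continuous_on[OF C_upto_SucD(3)[OF gb \<open>a \<in> Basis\<close>] \<open>S \<subseteq> T\<close>]])
qed

section \<open>Integrability and differentiation under the integral sign\<close>

text \<open>The continuous extension is integrable over the compact closure, hence over
  \<open>S\<close>, where it coincides with \<open>g\<close>.\<close>

lemma C_upto_0_set_integrable:
  assumes "C_upto 0 S (closure S) g" "open S" "bounded S"
  shows "set_integrable lborel S g"
proof -
  obtain h where h: "continuous_on (closure S) h" "\<And>x. x \<in> S \<Longrightarrow> h x = g x"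
    using assms(1) by (metis C_upto_0E)
  have "set_integrable lborel (closure S) h"
    unfolding set_integrable_def
    using assms(3) h(1) by (intro borel_integrable_compact) auto
  then have "set_integrable lborel S h"
    by (rule set_integrable_subset) (use assms(2) closure_subset in auto)
  then show ?thesis
    using h(2) set_integrable_cong[of lborel lborel S S h g] by simp
qed

text \<open>Dominated convergence applied to difference quotients in time. A constant dominates
  them: the mean value inequality bounds each quotient by the supremum of the time derivative near
  \<open>t\<close>, and constants are integrable over the bounded set \<open>S\<close>.\<close>

lemma has_real_derivative_set_integral:
  fixes G :: "'a::euclidean_space \<times> real \<Rightarrow> real"
  assumes G: "C_upto (Suc 0) (S \<times> I) (closure S \<times> I) G"
    and S: "open S" "bounded S" and "open I" "t \<in> I"
  shows "((\<lambda>s. LINT x:S|lborel. G (x, s)) has_real_derivative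
    (LINT x:S|lborel. frechet_derivative G (at (x, t)) (0, 1))) (at t)"
proof -
  let ?G' = "\<lambda>z. frechet_derivative G (at z) (0, 1)"
  have "(0, 1) \<in> (Basis :: ('a \<times> real) set)" by (simp add: Basis_prod_def)
  note G' = C_upto_SucD(3)[OF G this]
  \<comment> \<open>The uniform bound comes from the extension \<open>h\<close>, which is continuous
    on the compact product of \<open>closure S\<close> with a closed time interval around
    \<open>t\<close>; the time derivative inherits the bound at points of \<open>S\<close>.\<close>
  obtain h where h: "continuous_on (closure S \<times> I) h" "\<And>z. z \<in> S \<times> I \<Longrightarrow> h z = ?G' z"
    by (rule C_upto_0E[OF G']) blast
  obtain \<delta> where \<delta>: "\<delta> > 0" "cball t \<delta> \<subseteq> I"
    using \<open>open I\<close> \<open>t \<in> I\<close> by (metis open_contains_cball)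
  have "compact (h ` (closure S \<times> cball t \<delta>))"
    using S \<delta> by (intro compact_continuous_image continuous_on_subset[OF h(1)] compact_Times) auto
  then obtain B where B: "\<And>z. z \<in> closure S \<times> cball t \<delta> \<Longrightarrow> norm (h z) \<le> B"
    by (meson bounded_iff compact_imp_bounded imageI)
  have G'_le: "norm (?G' (x, s)) \<le> B" if "x \<in> S" "s \<in> ball t \<delta>" for x s
  proof -
    have "(x, s) \<in> closure S \<times> cball t \<delta>" "(x, s) \<in> S \<times> I"
      using that \<delta> closure_subset by auto
    then show ?thesis using B h(2) by metis
  qed
  have int: "set_integrable lborel S (\<lambda>x. G (x, s))" if "s \<in> I" for s
    by (intro C_upto_0_set_integrable C_upto_slice[OF S(1) \<open>open I\<close> that] C_upto_SucD(1)[OF G] S)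
  \<comment> \<open>Dominated convergence is a statement about sequences, so the limit of the
    quotients is taken along an arbitrary sequence of times tending to \<open>t\<close> and avoiding
    \<open>t\<close>.\<close>
  have lim: "(\<lambda>n. LINT x:S|lborel. (G (x, X n) - G (x, t)) / (X n - t)) \<longlonglongrightarrow> (LINT x:S|lborel. ?G' (x, t))"
    if X: "\<And>n. X n \<in> ball t \<delta> - {t}" "X \<longlonglongrightarrow> t" for X
    unfolding set_lebesgue_integral_def
  proof (rule integral_dominated_convergence)
    have "set_integrable lborel S (\<lambda>x. ?G' (x, t))"
      by (intro C_upto_0_set_integrable C_upto_slice[OF S(1) \<open>open I\<close> \<open>t \<in> I\<close>] G' S)
    then show "(\<lambda>x. indicat_real S x *\<^sub>R ?G' (x, t)) \<in> borel_measurable lborel"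
      unfolding set_integrable_def by (rule borel_measurable_integrable)
    have "set_integrable lborel S (\<lambda>x. (G (x, X n) - G (x, t)) / (X n - t))" for n
      using X(1)[of n] \<delta>(2) \<open>t \<in> I\<close> by (intro set_integrable_divide set_integral_diff int) auto
    then show "(\<lambda>x. indicat_real S x *\<^sub>R ((G (x, X n) - G (x, t)) / (X n - t))) \<in> borel_measurable lborel" for n
      unfolding set_integrable_def by (rule borel_measurable_integrable)
    have "set_integrable lborel S (\<lambda>x. B)"
      using S by (intro C_upto_0_set_integrable C_upto_0_const)
    then show "integrable lborel (\<lambda>x. indicat_real S x *\<^sub>R B)"
      unfolding set_integrable_def .
    have diff: "((\<lambda>s. G (x, s)) has_real_derivative ?G' (x, s)) (at s)" if "x \<in> S" "s \<in> I" for x s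
      using that by (intro has_real_derivative_slice C_upto_SucD(2)[OF G]) auto
    show "AE x in lborel. (\<lambda>n. indicat_real S x *\<^sub>R ((G (x, X n) - G (x, t)) / (X n - t)))
        \<longlonglongrightarrow> indicat_real S x *\<^sub>R ?G' (x, t)"
    proof (rule AE_I2)
      fix x
      show "(\<lambda>n. indicat_real S x *\<^sub>R ((G (x, X n) - G (x, t)) / (X n - t)))
        \<longlonglongrightarrow> indicat_real S x *\<^sub>R ?G' (x, t)"
      proof (cases "x \<in> S")
        case True
        have "((\<lambda>s. (G (x, s) - G (x, t)) / (s - t)) \<longlongrightarrow> ?G' (x, t)) (at t)"
          using diff[OF True \<open>t \<in> I\<close>] by (simp add: has_field_derivative_iff)
        then have "(\<lambda>n. (G (x, X n) - G (x, t)) / (X n - t)) \<longlonglongrightarrow> ?G' (x, t)"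
          using X unfolding tendsto_at_iff_sequentially comp_def by blast
        then show ?thesis by (intro tendsto_scaleR tendsto_const)
      qed simp
    qed
    show "AE x in lborel. norm (indicat_real S x *\<^sub>R ((G (x, X n) - G (x, t)) / (X n - t)))
        \<le> indicat_real S x *\<^sub>R B" for n
    proof (rule AE_I2)
      fix x
      show "norm (indicat_real S x *\<^sub>R ((G (x, X n) - G (x, t)) / (X n - t))) \<le> indicat_real S x *\<^sub>R B"
      proof (cases "x \<in> S")
        case True
        \<comment> \<open>The time ball is convex, so the bound \<open>B\<close> on the derivative
          makes each slice Lipschitz there with constant \<open>B\<close>; this bounds the
          quotient.\<close>
        have der: "((\<lambda>s. G (x, s)) has_real_derivative ?G' (x, s)) (at s within ball t \<delta>)"
          if "s \<in> ball t \<delta>" for s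
        proof -
          have "s \<in> I" using \<delta>(2) that by auto
          then show ?thesis by (rule has_field_derivative_at_within[OF diff[OF True]])
        qed
        have "X n \<in> ball t \<delta>" "t \<in> ball t \<delta>"
          using \<delta>(1) X(1)[of n] by simp_all
        with field_differentiable_bound[OF convex_ball der G'_le[OF True]]
        have "norm (G (x, X n) - G (x, t)) \<le> B * norm (X n - t)"
          by blast
        then show ?thesis
          using True X(1)[of n] by (simp add: divide_le_eq)
      qed simp
    qed
  qed
  have "(\<lambda>n. ((LINT x:S|lborel. G (x, X n)) - (LINT x:S|lborel. G (x, t))) / (X n - t))
      \<longlonglongrightarrow> (LINT x:S|lborel. ?G' (x, t))"
    if X: "\<And>n. X n \<in> ball t \<delta> - {t}" "X \<longlonglongrightarrow> t" for X
  proof -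
    have "X n \<in> I" for n using X(1)[of n] \<delta>(2) by auto
    then have "((LINT x:S|lborel. G (x, X n)) - (LINT x:S|lborel. G (x, t))) / (X n - t) =
        (LINT x:S|lborel. (G (x, X n) - G (x, t)) / (X n - t))" for n
      using int \<open>t \<in> I\<close> by (simp add: set_integral_diff(2))
    then show ?thesis using lim[OF X] by (simp only:)
  qed
  then have "((\<lambda>s. ((LINT x:S|lborel. G (x, s)) - (LINT x:S|lborel. G (x, t))) / (s - t))
      \<longlongrightarrow> (LINT x:S|lborel. ?G' (x, t))) (at t within ball t \<delta>)"
    unfolding tendsto_at_iff_sequentially comp_def by blast
  then show ?thesis
    using \<delta> by (simp add: has_field_derivative_iff at_within_open[of t "ball t \<delta>"])
qed

section \<open>Gradient, divergence and integration by parts under Neumann conditions\<close>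

lemma grad_inner_Basis: "b \<in> Basis \<Longrightarrow> grad g x \<bullet> b = frechet_derivative g (at x) b"
  by (simp add: grad_def inner_sum_left inner_Basis if_distrib cong: if_cong)

lemma grad_inner_grad:
  "grad f x \<bullet> grad g x = (\<Sum>b\<in>Basis. frechet_derivative f (at x) b * frechet_derivative g (at x) b)"
  by (subst euclidean_inner) (simp add: grad_inner_Basis)

lemma divergence_sum_Basis:
  assumes "\<And>b. b \<in> Basis \<Longrightarrow> w b differentiable (at x)"
  shows "(\<lambda>y. \<Sum>b\<in>Basis. w b y *\<^sub>R b) differentiable (at x)"
    and "divergence (\<lambda>y. \<Sum>b\<in>Basis. w b y *\<^sub>R b) x = (\<Sum>b\<in>Basis. frechet_derivative (w b) (at x) b)"
proof -
  have der: "((\<lambda>y. \<Sum>b\<in>Basis. w b y *\<^sub>R b) has_derivative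
      (\<lambda>h. \<Sum>b\<in>Basis. frechet_derivative (w b) (at x) h *\<^sub>R b)) (at x)"
    by (rule has_derivative_sum, rule has_derivative_scaleR_left)
      (rule has_derivative_frechet_derivative[OF assms])
  then show "(\<lambda>y. \<Sum>b\<in>Basis. w b y *\<^sub>R b) differentiable (at x)" by (rule differentiableI)
  show "divergence (\<lambda>y. \<Sum>b\<in>Basis. w b y *\<^sub>R b) x = (\<Sum>b\<in>Basis. frechet_derivative (w b) (at x) b)"
    by (simp add: divergence_def frechet_derivative_at[OF der, symmetric] inner_sum_left inner_Basis
        if_distrib cong: if_cong)
qed

lemma divergence_cong:
  assumes "v differentiable (at x)" "open S" "x \<in> S" "\<And>y. y \<in> S \<Longrightarrow> v y = w y"
  shows "divergence w x = divergence v x"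
  using frechet_derivative_transform_within_open[OF assms] by (simp add: divergence_def)

lemma frechet_derivative_mult:
  fixes f g :: "'a::real_normed_vector \<Rightarrow> real"
  assumes "f differentiable (at x)" "g differentiable (at x)"
  shows "frechet_derivative (\<lambda>y. f y * g y) (at x) h =
    f x * frechet_derivative g (at x) h + frechet_derivative f (at x) h * g x"
  by (rule fun_cong[OF frechet_derivative_at[OF has_derivative_mult[OF
          has_derivative_frechet_derivative[OF assms(1)] has_derivative_frechet_derivative[OF assms(2)]]],
        symmetric])

text \<open>A frontier point of an open set lies outside the set but is a limit of its points, so
  the limit within \<open>S\<close> is not vacuous and is unique. This ties
  \<open>normal_derivative\<close> to the extended gradient that enters the boundary
  integral.\<close>

lemma grad_extension_eq_Lim:
  assumes "open S" "x \<in> frontier S" "continuous_on (closure S) h" "\<And>y. y \<in> S \<Longrightarrow> h y = grad g y"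
  shows "Lim (at x within S) (grad g) = h x"
proof (rule tendsto_Lim)
  have x: "x \<in> closure S" "x \<notin> S"
    using assms(1,2) by (auto simp: frontier_def interior_open)
  then show "at x within S \<noteq> bot"
    by (simp add: trivial_limit_within closure_def)
  have "(h \<longlongrightarrow> h x) (at x within S)"
    using assms(3) x(1) closure_subset by (auto simp: continuous_on_def intro: tendsto_within_subset)
  moreover have "\<forall>\<^sub>F y in at x within S. h y = grad g y"
    using assms(4) by (simp add: eventually_at_filter)
  ultimately show "(grad g \<longlongrightarrow> h x) (at x within S)"
    by (rule Lim_transform_eventually)
qed

lemma divergence_mult_grad:
  assumes "C_upto (Suc 0) S T c" "C_upto (Suc (Suc 0)) S T g" "x \<in> S"
  shows "divergence (\<lambda>y. c y *\<^sub>R grad g y) x =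
    (\<Sum>b\<in>Basis. frechet_derivative (\<lambda>y. c y * frechet_derivative g (at y) b) (at x) b)"
proof -
  have "(\<lambda>y. c y * frechet_derivative g (at y) b) differentiable (at x)" if "b \<in> Basis" for b
    by (intro differentiable_mult C_upto_SucD(2)[OF assms(1,3)]
        C_upto_SucD(2)[OF C_upto_SucD(3)[OF assms(2) that] assms(3)])
  from divergence_sum_Basis(2)[of "\<lambda>b y. c y * frechet_derivative g (at y) b", OF this]
  show ?thesis by (simp add: grad_def scaleR_sum_right)
qed

text \<open>The coordinates of the field are products of C^1 functions, so its divergence is
  continuous up to the boundary. This supplies the integrability of the second-order terms in the
  energy law.\<close>

lemma C_upto_0_divergence_mult_grad:
  assumes "C_upto (Suc 0) S T c" "C_upto (Suc (Suc 0)) S T g" "open S"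
  shows "C_upto 0 S T (divergence (\<lambda>y. c y *\<^sub>R grad g y))"
proof (rule C_upto_cong[OF \<open>open S\<close>])
  have "C_upto 0 S T (\<lambda>x. frechet_derivative (\<lambda>y. c y * frechet_derivative g (at y) b) (at x) b)"
    if "b \<in> Basis" for b
    by (rule C_upto_SucD(3)[OF C_upto_Suc0_mult[OF assms(1) C_upto_SucD(3)[OF assms(2) that] assms(3)] that])
  then show "C_upto 0 S T (\<lambda>x. \<Sum>b\<in>Basis. frechet_derivative (\<lambda>y. c y * frechet_derivative g (at y) b) (at x) b)"
    by (rule C_upto_0_sum)
qed (simp add: divergence_mult_grad[OF assms(1,2)])

lemma C_upto_0_grad_inner_grad:
  assumes "C_upto (Suc 0) S T f" "C_upto (Suc 0) S T g"
  shows "C_upto 0 S T (\<lambda>x. grad f x \<bullet> grad g x)"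
  unfolding grad_inner_grad
  by (rule C_upto_0_sum, rule C_upto_0_mult) (rule C_upto_SucD(3)[OF assms(1)] C_upto_SucD(3)[OF assms(2)]; assumption)+

text \<open>Green's identity: by the product rule the integrand is the divergence of
  \<open>a\<close> times \<open>c\<close> times the gradient of \<open>g\<close>, and the flux of
  this field through the boundary contains the normal derivative of \<open>g\<close> as a
  factor.\<close>

lemma integral_Neumann_eq_0:
  assumes dom: "divergence_theorem_domain S"
    and a: "C_upto (Suc 0) S (closure S) a" and c: "C_upto (Suc 0) S (closure S) c"
    and g: "C_upto (Suc (Suc 0)) S (closure S) g"
    and bc: "AE x\<in>frontier S in surface_measure. normal_derivative S g x = 0"
  shows "(LINT x:S|lborel. a x * divergence (\<lambda>y. c y *\<^sub>R grad g y) x + c x * (grad a x \<bullet> grad g x)) = 0"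
proof -
  have "open S" using dom by (simp add: divergence_theorem_domain_def)
  note gb = C_upto_SucD(3)[OF g]
  have "\<exists>h. continuous_on (closure S) h \<and> (\<forall>x\<in>S. h x = frechet_derivative g (at x) b)"
    if "b \<in> Basis" for b
    using gb[OF that, THEN C_upto_imp_0] by (metis C_upto_0E)
  \<comment> \<open>The divergence theorem evaluates the field on the frontier, where
    \<open>a\<close>, \<open>c\<close> and the derivatives of \<open>g\<close> carry no information.
    The field is therefore built from extensions: \<open>H b\<close> of the partial derivatives of
    \<open>g\<close>, and \<open>k\<close> of the product of \<open>a\<close> and
    \<open>c\<close>.\<close>
  then obtain H where H: "\<And>b. b \<in> Basis \<Longrightarrow> continuous_on (closure S) (H b)"
    "\<And>b x. b \<in> Basis \<Longrightarrow> x \<in> S \<Longrightarrow> H b x = frechet_derivative g (at x) b"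
    by metis
  obtain k where k: "continuous_on (closure S) k" "\<And>x. x \<in> S \<Longrightarrow> k x = a x * c x"
    by (rule C_upto_0E[OF C_upto_Suc0_mult[OF a c \<open>open S\<close>, THEN C_upto_imp_0]]) blast
  define V where "V y = (\<Sum>b\<in>Basis. H b y *\<^sub>R b)" for y
  define v where "v y = k y *\<^sub>R V y" for y
  have V: "continuous_on (closure S) V" "\<And>y. y \<in> S \<Longrightarrow> V y = grad g y"
    using H by (auto simp: V_def[abs_def] grad_def intro!: continuous_intros)
  have v_eq: "v y = (\<Sum>b\<in>Basis. (a y * (c y * frechet_derivative g (at y) b)) *\<^sub>R b)" if "y \<in> S" for y
    using that by (simp add: v_def V k(2) grad_def scaleR_sum_right mult.assoc)
  have cgb: "C_upto (Suc 0) S (closure S) (\<lambda>y. c y * frechet_derivative g (at y) b)" if "b \<in> Basis" for b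
    by (rule C_upto_Suc0_mult[OF c gb[OF that] \<open>open S\<close>])
  note acgb = C_upto_Suc0_mult[OF a cgb \<open>open S\<close>]
  have "continuous_on (closure S) v"
    unfolding v_def[abs_def] using k(1) V(1) by (intro continuous_intros)
  moreover have "C_upto 1 S (closure S) (\<lambda>x. v x \<bullet> b)" if "b \<in> Basis" for b
    unfolding One_nat_def
    by (rule C_upto_cong[OF \<open>open S\<close> _ acgb[OF that]])
      (simp add: v_eq inner_sum_left inner_Basis that if_distrib cong: if_cong)
  ultimately have "(LINT x:S|lborel. divergence v x) =
      (LINT x:frontier S|surface_measure. v x \<bullet> outward_normal S x)"
    using dom by (simp add: divergence_theorem_domain_def)
  also have "\<dots> = 0"
    unfolding set_lebesgue_integral_def
  proof (rule integral_eq_zero_AE)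
    \<comment> \<open>At a frontier point \<open>V x\<close> is the limit of the interior gradients,
      so the flux density is \<open>k x\<close> times the normal derivative.\<close>
    have "v x \<bullet> outward_normal S x = k x * normal_derivative S g x" if "x \<in> frontier S" for x
      by (simp add: normal_derivative_def grad_extension_eq_Lim[OF \<open>open S\<close> that V] v_def)
    then show "AE x in surface_measure. indicat_real (frontier S) x *\<^sub>R (v x \<bullet> outward_normal S x) = 0"
      using bc by (auto elim!: eventually_mono simp: indicator_def)
  qed
  also have "(LINT x:S|lborel. divergence v x) =
      (LINT x:S|lborel. a x * divergence (\<lambda>y. c y *\<^sub>R grad g y) x + c x * (grad a x \<bullet> grad g x))"
  proof (rule set_lebesgue_integral_cong, use \<open>open S\<close> in simp, intro allI impI)
    fix x assume "x \<in> S"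
    note dif = C_upto_SucD(2)[OF a \<open>x \<in> S\<close>] C_upto_SucD(2)[OF cgb \<open>x \<in> S\<close>] C_upto_SucD(2)[OF acgb \<open>x \<in> S\<close>]
    note div = divergence_sum_Basis[of "\<lambda>b y. a y * (c y * frechet_derivative g (at y) b)", OF dif(3)]
    have "divergence v x = divergence (\<lambda>y. \<Sum>b\<in>Basis. (a y * (c y * frechet_derivative g (at y) b)) *\<^sub>R b) x"
      by (rule divergence_cong[OF div(1) \<open>open S\<close> \<open>x \<in> S\<close>]) (simp_all add: v_eq)
    also have "\<dots> = (\<Sum>b\<in>Basis. frechet_derivative (\<lambda>y. a y * (c y * frechet_derivative g (at y) b)) (at x) b)"
      by (rule div(2))
    also have "\<dots> = (\<Sum>b\<in>Basis. a x * frechet_derivative (\<lambda>y. c y * frechet_derivative g (at y) b) (at x) b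
        + c x * (frechet_derivative a (at x) b * frechet_derivative g (at x) b))"
      by (rule sum.cong) (simp_all add: frechet_derivative_mult[OF dif(1,2)])
    also have "\<dots> = a x * divergence (\<lambda>y. c y *\<^sub>R grad g y) x + c x * (grad a x \<bullet> grad g x)"
      by (simp add: divergence_mult_grad[OF c g \<open>x \<in> S\<close>] grad_inner_grad sum.distrib sum_distrib_left)
    finally show "divergence v x = a x * divergence (\<lambda>y. c y *\<^sub>R grad g y) x + c x * (grad a x \<bullet> grad g x)" .
  qed
  finally show ?thesis .
qed

section \<open>Finite sums of integrals, the double-well potential and the chain rule in
  time\<close>

lemma set_integral_sum:
  fixes f :: "'i \<Rightarrow> 'a \<Rightarrow> real"
  assumes "\<And>i. i \<in> J \<Longrightarrow> set_integrable M A (f i)"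
  shows "(LINT x:A|M. \<Sum>i\<in>J. f i x) = (\<Sum>i\<in>J. LINT x:A|M. f i x)"
  using assms by (simp add: set_integrable_def set_lebesgue_integral_def sum_distrib_left)

text \<open>Since \<open>f_pot\<close> is defined as \<open>deriv F_pot\<close>, it is enough to
  exhibit some derivative of \<open>F_pot\<close> at each point.\<close>

lemma F_pot_has_real_derivative: "(F_pot has_real_derivative f_pot p) (at p)"
proof -
  have "(F_pot has_real_derivative p * (p\<^sup>2 - 1)) (at p)"
    unfolding F_pot_def[abs_def]
    by (auto intro!: derivative_eq_intros simp: field_simps power2_eq_square)
  then show ?thesis
    using DERIV_imp_deriv f_pot_def by metis
qed

lemma C_upto_Suc0_F_pot:
  assumes "C_upto (Suc 0) S T u" "open S"
  shows "C_upto (Suc 0) S T (\<lambda>z. F_pot (u z))"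
proof -
  have "(\<lambda>z. F_pot (u z)) = (\<lambda>z. 1 / 4 * ((u z * u z + - 1) * (u z * u z + - 1)))"
    by (simp add: F_pot_def power2_eq_square)
  then show ?thesis
    using assms by (simp only:) (intro C_upto_Suc0_mult C_upto_Suc0_add C_upto_Suc0_const)
qed

lemma has_real_derivative_smooth_compose:
  fixes u :: "real \<Rightarrow> real ^ 'n"
  assumes "smooth g" and "\<And>i. ((\<lambda>s. u s $ i) has_real_derivative u' i) (at t)"
  shows "((\<lambda>s. g (u s)) has_real_derivative (\<Sum>i\<in>UNIV. partial_deriv i g (u t) * u' i)) (at t)"
proof -
  have "((\<lambda>s. g (u s)) has_derivative (\<lambda>h. \<Sum>i\<in>UNIV. partial_deriv i g (u t) * (u' i * h))) (at t)"
    using assms(2) unfolding has_field_derivative_def by (rule has_derivative_smooth_compose[OF assms(1)])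
  moreover have "(\<lambda>h. \<Sum>i\<in>UNIV. partial_deriv i g (u t) * (u' i * h)) =
      (*) (\<Sum>i\<in>UNIV. partial_deriv i g (u t) * u' i)"
    by (simp add: fun_eq_iff sum_distrib_right mult.assoc)
  ultimately show ?thesis by (simp only: has_field_derivative_def)
qed

section \<open>The energy law\<close>

theorem mainTheorem2:
  fixes N :: nat
    and \<Omega> :: "(real ^ 'd::finite) set"
    and I :: "real set"
    and \<epsilon> :: "'n::finite \<Rightarrow> real"
    and \<gamma> M :: "'n \<Rightarrow> real ^ 'n \<Rightarrow> real"
    and \<Phi> \<mu> :: "real ^ 'd \<Rightarrow> real \<Rightarrow> real ^ 'n"
  assumes "N \<ge> 2" and "CARD('n) = N - 1"
    and "CARD('d) = 2 \<or> CARD('d) = 3"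
    and "divergence_theorem_domain \<Omega>"
    and "open I" and "is_interval I"
    and "\<And>i. \<epsilon> i > 0"
    and "\<And>i. smooth (\<gamma> i)"
    and "\<And>i u v. (\<And>j. j \<noteq> i \<Longrightarrow> u $ j = v $ j) \<Longrightarrow> \<gamma> i u = \<gamma> i v"
    and "\<And>i. smooth (M i)"
    and "\<And>i u. M i u \<ge> 0"
    and "sufficiently_smooth \<Omega> I \<Phi> \<mu>"
    and "cahn_hilliard_system \<Omega> I \<epsilon> \<gamma> M \<Phi> \<mu>"
  shows "\<forall>t\<in>I.
    ((\<lambda>s. mixing_energy \<Omega> \<epsilon> \<gamma> (\<lambda>x. \<Phi> x s)) has_real_derivative
      - (LINT x:\<Omega>|lborel. \<Sum>i\<in>UNIV. M i (\<Phi> x t) * (norm (grad (\<lambda>y. \<mu> y t $ i) x))\<^sup>2)) (at t) \<and>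
    - (LINT x:\<Omega>|lborel. \<Sum>i\<in>UNIV. M i (\<Phi> x t) * (norm (grad (\<lambda>y. \<mu> y t $ i) x))\<^sup>2) \<le> 0"
proof (intro ballI conjI)
  fix t assume "t \<in> I"
  have \<Omega>: "open \<Omega>" "bounded \<Omega>"
    using assms(4) by (auto simp: divergence_theorem_domain_def)
  have prod: "open (\<Omega> \<times> I)" "\<Omega> \<times> I \<subseteq> closure \<Omega> \<times> I"
    using \<Omega> \<open>open I\<close> closure_subset by (auto intro: open_Times)
  note slice = C_upto_slice[OF \<Omega>(1) \<open>open I\<close>, where T = "closure \<Omega>"]
  note gamma = assms(8) and smooth_M = assms(10)

  \<comment> \<open>The phase fields are viewed as functions of one space-time variable, since the
    joint regularity is stated on \<open>\<Omega> \<times> I\<close>. The functions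
    \<open>p b i\<close> and \<open>q i\<close> below are their spatial and temporal first
    derivatives, again C^1 in space-time.\<close>
  define U where "U z = \<Phi> (fst z) (snd z)" for z
  have U_Pair [simp]: "U (x, s) = \<Phi> x s" for x s by (simp add: U_def)
  have U: "C_upto (Suc (Suc 0)) (\<Omega> \<times> I) (closure \<Omega> \<times> I) (\<lambda>z. U z $ i)" for i
    using assms(12) by (simp add: sufficiently_smooth_def U_def numeral_2_eq_2 case_prod_unfold)
  note U1 = C_upto_Suc_imp[OF U]
  define p where "p b i z = frechet_derivative (\<lambda>z. U z $ i) (at z) (b, 0)" for b i z
  define q where "q i z = frechet_derivative (\<lambda>z. U z $ i) (at z) (0, 1)" for i z
  have Basis_prod: "(b, 0) \<in> (Basis :: ((real ^ 'd) \<times> real) set)" if "b \<in> Basis" for b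
    using that by (simp add: Basis_prod_def)
  have Basis_time: "(0, 1) \<in> (Basis :: ((real ^ 'd) \<times> real) set)"
    by (simp add: Basis_prod_def)
  have p: "C_upto (Suc 0) (\<Omega> \<times> I) (closure \<Omega> \<times> I) (p b i)" if "b \<in> Basis" for b i
    unfolding p_def[abs_def] by (rule C_upto_SucD(3)[OF U Basis_prod[OF that]])
  have q: "C_upto (Suc 0) (\<Omega> \<times> I) (closure \<Omega> \<times> I) (q i)" for i
    unfolding q_def[abs_def] by (rule C_upto_SucD(3)[OF U Basis_time])
  have mixed: "frechet_derivative (p b i) (at z) (0, 1) = frechet_derivative (q i) (at z) (b, 0)"
    if "b \<in> Basis" "z \<in> \<Omega> \<times> I" for b i z
    using C_upto_2_mixed_derivatives_commute[OF U[folded numeral_2_eq_2] prod that(2) Basis_prod[OF that(1)] Basis_time]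
    by (simp add: p_def[abs_def] q_def[abs_def])

  \<comment> \<open>This is the energy density with the gradient of each time slice replaced by the
    space-time derivatives \<open>p\<close>. In this form \<open>G\<close> is visibly C^1 jointly in
    space and time, as differentiation under the integral demands.\<close>
  define e where "e i z = \<epsilon> i / 2 * (\<Sum>b\<in>Basis. p b i z * p b i z) + 1 / \<epsilon> i * F_pot (U z $ i)" for i z
  define G where "G z = (\<Sum>i\<in>UNIV. \<gamma> i (U z) * e i z)" for z
  have G: "C_upto (Suc 0) (\<Omega> \<times> I) (closure \<Omega> \<times> I) G"
    unfolding G_def[abs_def] e_def[abs_def]
    by (intro C_upto_Suc0_sum C_upto_Suc0_mult C_upto_Suc0_smooth_compose[OF gamma]
        C_upto_Suc0_add C_upto_Suc0_F_pot U1 p C_upto_Suc0_const prod(1))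
  have grad_U: "frechet_derivative (\<lambda>y. \<Phi> y s $ i) (at x) b = p b i (x, s)"
    if "x \<in> \<Omega>" "s \<in> I" for x s i b
    using frechet_derivative_slice[OF C_upto_SucD(2)[OF U], of x s i b] that by (simp add: p_def)
  have energy: "energy_part \<epsilon> (\<lambda>y. \<Phi> y s) i x = e i (x, s)" if "x \<in> \<Omega>" "s \<in> I" for x s i
    using that by (simp add: energy_part_def e_def power2_norm_eq_inner grad_inner_grad grad_U)
  have "mixing_energy \<Omega> \<epsilon> \<gamma> (\<lambda>x. \<Phi> x s) = (LINT x:\<Omega>|lborel. G (x, s))" if "s \<in> I" for s
    unfolding mixing_energy_def
    by (rule set_lebesgue_integral_cong) (use \<Omega> that in \<open>auto simp: G_def energy\<close>)
  \<comment> \<open>The energy equals the integral of \<open>G\<close> only for times in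
    \<open>I\<close>; openness of \<open>I\<close> makes this enough for the derivative at
    \<open>t\<close>.\<close>
  then have deriv_energy: "((\<lambda>s. mixing_energy \<Omega> \<epsilon> \<gamma> (\<lambda>x. \<Phi> x s)) has_real_derivative
      (LINT x:\<Omega>|lborel. frechet_derivative G (at (x, t)) (0, 1))) (at t)"
    by (intro has_field_derivative_transform_within_open[OF
          has_real_derivative_set_integral[OF G \<Omega> \<open>open I\<close> \<open>t \<in> I\<close>] \<open>open I\<close> \<open>t \<in> I\<close>]) simp

  \<comment> \<open>From here on the time \<open>t\<close> is frozen: \<open>f\<close> and
    \<open>m\<close> are phase fields and potentials, \<open>c\<close> and \<open>d\<close> surface
    tensions and mobilities, and \<open>r\<close> is the time derivative of the phase fields, all as
    functions of space.\<close>
  define f where "f i y = \<Phi> y t $ i" for i y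
  define m where "m i y = \<mu> y t $ i" for i y
  define c where "c i y = \<gamma> i (\<Phi> y t)" for i y
  define d where "d i y = M i (\<Phi> y t)" for i y
  define r where "r i y = q i (y, t)" for i y
  have f: "C_upto (Suc (Suc 0)) \<Omega> (closure \<Omega>) (f i)" for i
    using slice[OF \<open>t \<in> I\<close> U[of i]] by (simp add: f_def[abs_def])
  have m: "C_upto (Suc (Suc 0)) \<Omega> (closure \<Omega>) (m i)" for i
    using assms(12) \<open>t \<in> I\<close> by (simp add: sufficiently_smooth_def m_def[abs_def] numeral_2_eq_2)
  have r: "C_upto (Suc 0) \<Omega> (closure \<Omega>) (r i)" for i
    using slice[OF \<open>t \<in> I\<close> q[of i]] by (simp add: r_def[abs_def])
  note \<Phi>1 = C_upto_Suc_imp[OF f, unfolded f_def]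
  have c: "C_upto (Suc 0) \<Omega> (closure \<Omega>) (c i)" for i
    unfolding c_def by (rule C_upto_Suc0_smooth_compose[OF gamma \<Phi>1 \<Omega>(1)])
  have d: "C_upto (Suc 0) \<Omega> (closure \<Omega>) (d i)" for i
    unfolding d_def by (rule C_upto_Suc0_smooth_compose[OF smooth_M \<Phi>1 \<Omega>(1)])
  note m1 = C_upto_Suc_imp[OF m]

  \<comment> \<open>\<open>A i\<close> is the Green integrand for testing the diffusion of
    \<open>f i\<close> with \<open>r i\<close>, and \<open>B i\<close> that for testing the
    diffusion of \<open>m i\<close> with \<open>m i\<close> itself. The Neumann conditions make both
    integrals vanish; \<open>D i\<close> is the dissipation density.\<close>
  define A where "A i x = r i x * divergence (\<lambda>y. c i y *\<^sub>R grad (f i) y) x + c i x * (grad (r i) x \<bullet> grad (f i) x)" for i x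
  define B where "B i x = m i x * divergence (\<lambda>y. d i y *\<^sub>R grad (m i) y) x + d i x * (grad (m i) x \<bullet> grad (m i) x)" for i x
  define D where "D i x = d i x * (grad (m i) x \<bullet> grad (m i) x)" for i x
  have bc: "AE x\<in>frontier \<Omega> in surface_measure. normal_derivative \<Omega> (f i) x = 0"
    "AE x\<in>frontier \<Omega> in surface_measure. normal_derivative \<Omega> (m i) x = 0" for i
    using assms(13) \<open>t \<in> I\<close>
    by (auto simp: cahn_hilliard_system_def f_def[abs_def] m_def[abs_def] elim!: eventually_mono)
  have A0: "(LINT x:\<Omega>|lborel. A i x) = 0" for i
    unfolding A_def by (rule integral_Neumann_eq_0[OF assms(4) r c f bc(1)])
  have B0: "(LINT x:\<Omega>|lborel. B i x) = 0" for i
    unfolding B_def by (rule integral_Neumann_eq_0[OF assms(4) m1 d m bc(2)])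
  have intA: "set_integrable lborel \<Omega> (A i)" for i
    unfolding A_def[abs_def]
    by (intro C_upto_0_set_integrable[OF _ \<Omega>] C_upto_0_add C_upto_0_mult C_upto_0_grad_inner_grad
        C_upto_0_divergence_mult_grad[OF c f \<Omega>(1)] r[THEN C_upto_imp_0] c[THEN C_upto_imp_0]
        r C_upto_Suc_imp[OF f])
  have intD: "set_integrable lborel \<Omega> (D i)" for i
    unfolding D_def[abs_def]
    by (intro C_upto_0_set_integrable[OF _ \<Omega>] C_upto_0_mult C_upto_0_grad_inner_grad
        d[THEN C_upto_imp_0] m1)
  have intB: "set_integrable lborel \<Omega> (B i)" for i
    unfolding B_def[abs_def]
    by (intro C_upto_0_set_integrable[OF _ \<Omega>] C_upto_0_add C_upto_0_mult C_upto_0_grad_inner_grad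
        C_upto_0_divergence_mult_grad[OF d m \<Omega>(1)] m1[THEN C_upto_imp_0] d[THEN C_upto_imp_0] m1)

  \<comment> \<open>Equality at each interior point, before any integration: both equations of the
    system are used here, and the boundary conditions are not.\<close>
  have dG: "frechet_derivative G (at (x, t)) (0, 1) = (\<Sum>i\<in>UNIV. \<epsilon> i * A i x + B i x - D i x)"
    if "x \<in> \<Omega>" for x
  proof -
    have xt: "(x, t) \<in> \<Omega> \<times> I" using that \<open>t \<in> I\<close> by simp
    have eq: "r i x = divergence (\<lambda>y. d i y *\<^sub>R grad (m i) y) x"
      "m i x = - \<epsilon> i * divergence (\<lambda>y. c i y *\<^sub>R grad (f i) y) x + 1 / \<epsilon> i * c i x * f_pot (f i x)
        + (\<Sum>j\<in>UNIV. partial_deriv i (\<gamma> j) (\<Phi> x t) * e j (x, t))" for i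
    proof -
      have "deriv (\<lambda>s. \<Phi> x s $ i) t = r i x"
        using has_real_derivative_slice[OF C_upto_SucD(2)[OF U xt], of i]
        by (intro DERIV_imp_deriv) (simp add: r_def q_def)
      then show "r i x = divergence (\<lambda>y. d i y *\<^sub>R grad (m i) y) x"
        "m i x = - \<epsilon> i * divergence (\<lambda>y. c i y *\<^sub>R grad (f i) y) x + 1 / \<epsilon> i * c i x * f_pot (f i x)
        + (\<Sum>j\<in>UNIV. partial_deriv i (\<gamma> j) (\<Phi> x t) * e j (x, t))"
        using assms(13) \<open>t \<in> I\<close> that
        by (simp_all add: cahn_hilliard_system_def energy f_def[abs_def] m_def[abs_def] c_def d_def)
    qed
    have dU: "((\<lambda>s. \<Phi> x s $ i) has_real_derivative r i x) (at t)" for i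
      using has_real_derivative_slice[OF C_upto_SucD(2)[OF U xt], of i] by (simp add: r_def q_def)
    \<comment> \<open>Symmetry of mixed derivatives enters here: the time derivative of a spatial
      derivative becomes a spatial derivative of the test function \<open>r i\<close>.\<close>
    have dp: "((\<lambda>s. p b i (x, s)) has_real_derivative frechet_derivative (r i) (at x) b) (at t)"
      if "b \<in> Basis" for b i
      using has_real_derivative_slice[OF C_upto_SucD(2)[OF p[OF that] xt], of i]
        frechet_derivative_slice[OF C_upto_SucD(2)[OF q xt], of i b] mixed[OF that xt, of i]
      by (simp add: r_def[abs_def])
    have p_eq: "p b i (x, t) = frechet_derivative (f i) (at x) b" for b i
      using grad_U[OF \<open>x \<in> \<Omega>\<close> \<open>t \<in> I\<close>] by (simp add: f_def[abs_def])
    have dF: "((\<lambda>s. F_pot (\<Phi> x s $ i)) has_real_derivative f_pot (f i x) * r i x) (at t)" for i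
      using DERIV_chain2[OF F_pot_has_real_derivative dU] by (simp add: f_def)
    have de: "((\<lambda>s. e i (x, s)) has_real_derivative
        \<epsilon> i * (grad (r i) x \<bullet> grad (f i) x) + 1 / \<epsilon> i * (f_pot (f i x) * r i x)) (at t)" for i
    proof -
      have "((\<lambda>s. \<Sum>b\<in>Basis. p b i (x, s) * p b i (x, s)) has_real_derivative
          (\<Sum>b\<in>Basis. frechet_derivative (r i) (at x) b * p b i (x, t)
            + frechet_derivative (r i) (at x) b * p b i (x, t))) (at t)"
        by (intro DERIV_sum DERIV_mult dp)
      also have "(\<Sum>b\<in>Basis. frechet_derivative (r i) (at x) b * p b i (x, t)
            + frechet_derivative (r i) (at x) b * p b i (x, t)) = 2 * (grad (r i) x \<bullet> grad (f i) x)"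
        by (simp add: p_eq grad_inner_grad sum_distrib_left mult_ac)
      finally have "((\<lambda>s. \<epsilon> i / 2 * (\<Sum>b\<in>Basis. p b i (x, s) * p b i (x, s)) + 1 / \<epsilon> i * F_pot (\<Phi> x s $ i))
          has_real_derivative \<epsilon> i / 2 * (2 * (grad (r i) x \<bullet> grad (f i) x)) + 1 / \<epsilon> i * (f_pot (f i x) * r i x)) (at t)"
        by (intro DERIV_add DERIV_cmult dF)
      then show ?thesis by (simp add: e_def)
    qed
    have dc: "((\<lambda>s. \<gamma> i (\<Phi> x s)) has_real_derivative
        (\<Sum>k\<in>UNIV. partial_deriv k (\<gamma> i) (\<Phi> x t) * r k x)) (at t)" for i
      by (rule has_real_derivative_smooth_compose[OF gamma dU])
    have "((\<lambda>s. G (x, s)) has_real_derivative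
        (\<Sum>i\<in>UNIV. (\<Sum>k\<in>UNIV. partial_deriv k (\<gamma> i) (\<Phi> x t) * r k x) * e i (x, t)
          + (\<epsilon> i * (grad (r i) x \<bullet> grad (f i) x) + 1 / \<epsilon> i * (f_pot (f i x) * r i x)) * c i x)) (at t)"
      unfolding G_def U_Pair c_def by (intro DERIV_sum DERIV_mult dc de)
    then have "frechet_derivative G (at (x, t)) (0, 1) =
        (\<Sum>i\<in>UNIV. (\<Sum>k\<in>UNIV. partial_deriv k (\<gamma> i) (\<Phi> x t) * r k x) * e i (x, t)
          + (\<epsilon> i * (grad (r i) x \<bullet> grad (f i) x) + 1 / \<epsilon> i * (f_pot (f i x) * r i x)) * c i x)"
      using has_real_derivative_slice[OF C_upto_SucD(2)[OF G xt]] by (rule DERIV_unique[rotated])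
    also have "\<dots> = (\<Sum>i\<in>UNIV. \<Sum>k\<in>UNIV. partial_deriv k (\<gamma> i) (\<Phi> x t) * r k x * e i (x, t))
        + (\<Sum>i\<in>UNIV. (\<epsilon> i * (grad (r i) x \<bullet> grad (f i) x) + 1 / \<epsilon> i * (f_pot (f i x) * r i x)) * c i x)"
      by (simp add: sum.distrib sum_distrib_right)
    \<comment> \<open>Exchanging the sums collects the factors of each \<open>r k x\<close>. The
      inner sum over all tensions is then exactly the coupling term in the equation for the
      \<open>k\<close>-th potential.\<close>
    also have "(\<Sum>i\<in>UNIV. \<Sum>k\<in>UNIV. partial_deriv k (\<gamma> i) (\<Phi> x t) * r k x * e i (x, t)) =
        (\<Sum>k\<in>UNIV. r k x * (\<Sum>i\<in>UNIV. partial_deriv k (\<gamma> i) (\<Phi> x t) * e i (x, t)))"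
      by (subst sum.swap) (simp add: sum_distrib_left mult_ac)
    also have "\<dots> + (\<Sum>i\<in>UNIV. (\<epsilon> i * (grad (r i) x \<bullet> grad (f i) x) + 1 / \<epsilon> i * (f_pot (f i x) * r i x)) * c i x)
        = (\<Sum>i\<in>UNIV. \<epsilon> i * A i x + r i x * m i x)"
      unfolding sum.distrib[symmetric]
    proof (rule sum.cong)
      fix i
      \<comment> \<open>The potential equation is solved for the coupling sum. After substitution
        the terms with \<open>f_pot\<close> cancel, and the divergence term joins the product of
        gradients to form \<open>\<epsilon> i * A i x\<close>.\<close>
      have "(\<Sum>j\<in>UNIV. partial_deriv i (\<gamma> j) (\<Phi> x t) * e j (x, t)) =
          m i x + \<epsilon> i * divergence (\<lambda>y. c i y *\<^sub>R grad (f i) y) x - 1 / \<epsilon> i * c i x * f_pot (f i x)"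
        using eq(2)[of i] by simp
      then show "r i x * (\<Sum>j\<in>UNIV. partial_deriv i (\<gamma> j) (\<Phi> x t) * e j (x, t))
          + (\<epsilon> i * (grad (r i) x \<bullet> grad (f i) x) + 1 / \<epsilon> i * (f_pot (f i x) * r i x)) * c i x
        = \<epsilon> i * A i x + r i x * m i x"
        by (simp only: A_def) (simp add: algebra_simps)
    qed simp
    \<comment> \<open>By the evolution equation \<open>r i x\<close> is the divergence inside
      \<open>B i x\<close>, and \<open>B i x - D i x\<close> leaves just this divergence times
      \<open>m i x\<close>.\<close>
    also have "\<dots> = (\<Sum>i\<in>UNIV. \<epsilon> i * A i x + B i x - D i x)"
      by (rule sum.cong) (simp_all add: B_def D_def flip: eq(1))
    finally show ?thesis .
  qed

  have D: "D i x = M i (\<Phi> x t) * (norm (grad (\<lambda>y. \<mu> y t $ i) x))\<^sup>2" for i x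
    by (simp add: D_def d_def m_def[abs_def] power2_norm_eq_inner)
  have "(LINT x:\<Omega>|lborel. frechet_derivative G (at (x, t)) (0, 1)) =
      (LINT x:\<Omega>|lborel. \<Sum>i\<in>UNIV. \<epsilon> i * A i x + B i x - D i x)"
    by (rule set_lebesgue_integral_cong) (use \<Omega> dG in auto)
  also have "\<dots> = (\<Sum>i\<in>UNIV. LINT x:\<Omega>|lborel. \<epsilon> i * A i x + B i x - D i x)"
    by (intro set_integral_sum set_integral_diff(1) set_integral_add(1) set_integrable_mult_right intA intB intD)
  \<comment> \<open>The integrals of \<open>A i\<close> and \<open>B i\<close> are zero, so only the
    dissipation remains.\<close>
  also have "\<dots> = (\<Sum>i\<in>UNIV. - (LINT x:\<Omega>|lborel. D i x))"
    by (simp add: set_integral_diff(2) set_integral_add(2) intA intB intD A0 B0)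
  also have "\<dots> = - (LINT x:\<Omega>|lborel. \<Sum>i\<in>UNIV. D i x)"
    by (simp add: set_integral_sum intD sum_negf)
  finally show "((\<lambda>s. mixing_energy \<Omega> \<epsilon> \<gamma> (\<lambda>x. \<Phi> x s)) has_real_derivative
      - (LINT x:\<Omega>|lborel. \<Sum>i\<in>UNIV. M i (\<Phi> x t) * (norm (grad (\<lambda>y. \<mu> y t $ i) x))\<^sup>2)) (at t)"
    using deriv_energy by (simp add: D)

  show "- (LINT x:\<Omega>|lborel. \<Sum>i\<in>UNIV. M i (\<Phi> x t) * (norm (grad (\<lambda>y. \<mu> y t $ i) x))\<^sup>2) \<le> 0"
    using assms(11) by (auto simp: set_lebesgue_integral_def intro!: Bochner_Integration.integral_nonneg mult_nonneg_nonneg sum_nonneg)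
qed

end
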